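(* Let $K$ be a simplicial complex and let $d\in\mathbb{N}$. Then $K$ is $d$-representable if and only if there exists a map $f:\|K'\|\to\mathbb{R}^d$ which is linear and faithful (for $K$), where $K'$ is the dual complex of $K$.
   Context: Simplicial complexes are finite: a simplicial complex $K\subseteq 2^V$ on a finite vertex set $V=V(K)$ is a family of subsets (faces) of $V$ closed under taking subsets, containing $\emptyset$ and with $\{i\}\in K$ for every $i\in V$. Inclusion-maximal faces are called facets, and $\mathsf m_K$ denotes the set of facets of $K$. $\mathbb N=\{1,2,\dots\}$. $K$ is $d$-representable if there are convex sets $C_i\subseteq\mathbb{R}^d$ ($i\in V$) with $K=\{I\subseteq V:\bigcap_{i\in I}C_i\neq\emptyset\}$. Dual complex: $K'=\{\alpha\subseteq \mathsf m_K:\bigcap\alpha\neq\emptyset\}$, where $\bigcap\alpha=\bigcap_{J\in\alpha}J\subseteq V$; it is a simplicial complex with vertex set $\mathsf m_K$. Geometric realization: for a simplicial complex $L$ with vertex set $W$ and $\{e_w\}_{w\in W}$ the standard basis of $\mathbb{R}^W$, $\|F\|=\mathrm{conv}\{e_w:w\in F\}$ for $F\in L$, and $\|L\|=\bigcup_{F\in L}\|F\|$. A map $\|L\|\to\mathbb{R}^d$ is linear if it is affine on each simplex $\|F\|$, $F\in L$ (i.e. it is the linear extension of its values on the vertices). For $i\in V$, $\gamma_i=\{J\in \mathsf m_K: i\in J\}$, which is a face of $K'$. A faithful map for $K$ is a continuous $f:\|K'\|\to\mathbb{R}^d$ such that every $I\subseteq V$ with $\bigcap_{i\in I}f(\|\gamma_i\|)\neq\emptyset$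 satisfies $I\in K$. *)

theory Defs
  imports "HOL-Analysis.Analysis" "HOL-Library.Function_Algebras"
begin

text \<open>
  The ambient space \<open>\<real>\<^sup>W\<close> of a geometric realization is modelled inside \<open>'w \<Rightarrow> real\<close>, for
  \<open>W\<close> a finite set of elements of type \<open>'w\<close>, as the functions vanishing outside \<open>W\<close>. The vector
  operations are pointwise; the topology is the product topology of Function_Topology, which
  induces the Euclidean topology on \<open>\<real>\<^sup>W\<close>.
\<close>

instantiation "fun" :: (type, real_vector) real_vector
begin

definition scaleR_fun :: "real \<Rightarrow> ('a \<Rightarrow> 'b) \<Rightarrow> 'a \<Rightarrow> 'b"
  where "scaleR_fun c x = (\<lambda>a. c *\<^sub>R x a)"

instance
  by standard (auto simp: scaleR_fun_def fun_eq_iff scaleR_add_right scaleR_add_left)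

end

text \<open>The name \<open>simplicial_complex\<close> is taken by geometric complexes in HOL-Analysis.\<close>

definition abstract_complex :: "'a set \<Rightarrow> 'a set set \<Rightarrow> bool" where
  "abstract_complex V K \<longleftrightarrow>
     finite V \<and> K \<subseteq> Pow V \<and> {} \<in> K \<and>
     (\<forall>I J. J \<in> K \<longrightarrow> I \<subseteq> J \<longrightarrow> I \<in> K) \<and>
     (\<forall>i\<in>V. {i} \<in> K)"

definition facets :: "'a set set \<Rightarrow> 'a set set" where
  "facets K = {J \<in> K. \<forall>I\<in>K. J \<subseteq> I \<longrightarrow> I = J}"

text \<open>
  The dimension \<open>d \<ge> 1\<close> is \<open>CARD('d)\<close>. For \<open>I = {}\<close> the intersection is the whole space.
\<close>

definition representable :: "'d::finite itself \<Rightarrow> 'a set \<Rightarrow> 'a set set \<Rightarrow> bool" where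
  "representable _ V K \<longleftrightarrow>
     (\<exists>C :: 'a \<Rightarrow> (real ^ 'd) set.
        (\<forall>i\<in>V. convex (C i)) \<and> K = {I. I \<subseteq> V \<and> (\<Inter>i\<in>I. C i) \<noteq> {}})"

text \<open>
  Intersections of families of faces are taken inside \<open>V\<close>, so the empty family has
  intersection \<open>V\<close>.
\<close>

definition dual_complex :: "'a set \<Rightarrow> 'a set set \<Rightarrow> 'a set set set" where
  "dual_complex V K = {\<alpha>. \<alpha> \<subseteq> facets K \<and> V \<inter> \<Inter>\<alpha> \<noteq> {}}"

definition std_basis :: "'w \<Rightarrow> 'w \<Rightarrow> real" where
  "std_basis w = (\<lambda>v. if v = w then 1 else 0)"

definition face_realization :: "'w set \<Rightarrow> ('w \<Rightarrow> real) set" where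
  "face_realization F = convex hull (std_basis ` F)"

definition realization :: "'w set set \<Rightarrow> ('w \<Rightarrow> real) set" where
  "realization L = (\<Union>F\<in>L. face_realization F)"

definition affine_map_on :: "'x::real_vector set \<Rightarrow> ('x \<Rightarrow> 'y::real_vector) \<Rightarrow> bool" where
  "affine_map_on S f \<longleftrightarrow>
     (\<forall>x\<in>S. \<forall>y\<in>S. \<forall>t. 0 \<le> t \<longrightarrow> t \<le> 1 \<longrightarrow>
        f ((1 - t) *\<^sub>R x + t *\<^sub>R y) = (1 - t) *\<^sub>R f x + t *\<^sub>R f y)"

definition linear_on_realization :: "'w set set \<Rightarrow> (('w \<Rightarrow> real) \<Rightarrow> 'y::real_vector) \<Rightarrow> bool" where
  "linear_on_realization L f \<longleftrightarrow> (\<forall>F\<in>L. affine_map_on (face_realization F) f)"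

definition facets_at :: "'a set set \<Rightarrow> 'a \<Rightarrow> 'a set set" where
  "facets_at K i = {J \<in> facets K. i \<in> J}"

definition faithful ::
  "'a set \<Rightarrow> 'a set set \<Rightarrow> (('a set \<Rightarrow> real) \<Rightarrow> 'y::topological_space) \<Rightarrow> bool" where
  "faithful V K f \<longleftrightarrow>
     continuous_on (realization (dual_complex V K)) f \<and>
     (\<forall>I. I \<subseteq> V \<longrightarrow> (\<Inter>i\<in>I. f ` face_realization (facets_at K i)) \<noteq> {} \<longrightarrow> I \<in> K)"

end

theory Submission
  imports Defs
begin

text \<open>
  If \<open>K\<close> is represented by convex sets \<open>C\<^sub>i\<close>, send the vertex \<open>J\<close> of the dual complex to a point of
  \<open>\<Inter>\<^sub>i\<^sub>\<in>\<^sub>J C\<^sub>i\<close> and extend linearly: by convexity the image of \<open>\<parallel>\<gamma>\<^sub>i\<parallel>\<close> lies in \<open>C\<^sub>i\<close>, so the extension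
  is faithful. Conversely, the images of the \<open>\<parallel>\<gamma>\<^sub>i\<parallel>\<close> under a linear faithful map are convex, and
  those with \<open>i \<in> J\<close> share the image of the vertex \<open>J\<close>, so they represent \<open>K\<close>.
\<close>

lemma convex_affine_map_on_image:
  assumes "affine_map_on S f" "convex S"
  shows "convex (f ` S)"
  unfolding convex_alt
proof (clarify)
  fix x y :: 'a and u :: real
  assume xy: "x \<in> S" "y \<in> S" and u: "0 \<le> u" "u \<le> 1"
  have "(1 - u) *\<^sub>R x + u *\<^sub>R y \<in> S"
    using \<open>convex S\<close> xy u unfolding convex_alt by blast
  moreover have "f ((1 - u) *\<^sub>R x + u *\<^sub>R y) = (1 - u) *\<^sub>R f x + u *\<^sub>R f y"
    using assms(1) xy u unfolding affine_map_on_def by blast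
  ultimately show "(1 - u) *\<^sub>R f x + u *\<^sub>R f y \<in> f ` S"
    by (metis imageI)
qed

lemma linear_imp_affine_map_on: "linear f \<Longrightarrow> affine_map_on S f"
  by (simp add: affine_map_on_def linear_add linear_scale)

lemma finite_facets:
  assumes "abstract_complex V K"
  shows "finite (facets K)"
proof (rule finite_subset)
  show "facets K \<subseteq> Pow V" "finite (Pow V)"
    using assms by (auto simp: abstract_complex_def facets_def)
qed

lemma face_subset_facet:
  assumes "abstract_complex V K" "I \<in> K"
  obtains J where "J \<in> facets K" "I \<subseteq> J"
proof -
  have "finite K"
    using assms(1) by (meson abstract_complex_def finite_Pow_iff finite_subset)
  from finite_has_maximal2[OF this \<open>I \<in> K\<close>] show ?thesis
    using that unfolding facets_def by blast
qed

text \<open>The point \<open>i\<close> itself lies in \<open>V\<close> and in every facet of the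
  family, so the intersection is nonempty.\<close>

lemma facets_at_in_dual_complex: "i \<in> V \<Longrightarrow> facets_at K i \<in> dual_complex V K"
  by (auto simp: facets_at_def dual_complex_def)

lemma representable_if_linear_faithful:
  fixes f :: "('a set \<Rightarrow> real) \<Rightarrow> real ^ 'd::finite"
  assumes K: "abstract_complex V K"
    and lin: "linear_on_realization (dual_complex V K) f"
    and faithful: "faithful V K f"
  shows "representable TYPE('d) V K"
  unfolding representable_def
proof (intro exI conjI ballI equalityI subsetI)
  let ?C = "\<lambda>i. f ` face_realization (facets_at K i)"
  \<comment> \<open>\<open>f\<close> is affine only simplex by simplex; the image is convex because
    the facets at \<open>i\<close> span a single simplex of the dual complex.\<close>
  show "convex (?C i)" if "i \<in> V" for i
    using lin facets_at_in_dual_complex[OF that, of K]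
    by (intro convex_affine_map_on_image)
      (auto simp: linear_on_realization_def face_realization_def)
  show "I \<in> {I. I \<subseteq> V \<and> (\<Inter>i\<in>I. ?C i) \<noteq> {}}" if I: "I \<in> K" for I
  proof -
    \<comment> \<open>Only facets are vertices of the dual complex, so \<open>I\<close> is enlarged
      to a facet \<open>J\<close>; the vertex \<open>J\<close> then belongs to the simplex of every
      \<open>i \<in> I\<close>.\<close>
    obtain J where J: "J \<in> facets K" "I \<subseteq> J"
      using face_subset_facet[OF K I] .
    have "std_basis J \<in> face_realization (facets_at K i)" if "i \<in> I" for i
      using J that unfolding face_realization_def by (auto simp: facets_at_def intro: hull_inc)
    then have "f (std_basis J) \<in> (\<Inter>i\<in>I. ?C i)"
      by blast
    moreover have "I \<subseteq> V"
      using K I by (auto simp: abstract_complex_def)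
    ultimately show ?thesis
      by blast
  qed
  show "I \<in> K" if "I \<in> {I. I \<subseteq> V \<and> (\<Inter>i\<in>I. ?C i) \<noteq> {}}" for I
    using that faithful unfolding faithful_def by blast
qed

text \<open>Defined on the whole function space rather than on the realization: global linearity
  yields affinity on all simplices at once, with no gluing along common faces.\<close>

definition linear_extension :: "'w set \<Rightarrow> ('w \<Rightarrow> 'y::real_vector) \<Rightarrow> ('w \<Rightarrow> real) \<Rightarrow> 'y" where
  "linear_extension W p x = (\<Sum>w\<in>W. x w *\<^sub>R p w)"

lemma linear_linear_extension: "linear (linear_extension W p)"
  by (rule linearI)
    (simp_all add: linear_extension_def scaleR_fun_def scaleR_add_left sum.distrib scaleR_sum_right)

lemma continuous_on_linear_extension:
  fixes p :: "'w \<Rightarrow> 'y::real_normed_vector"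
  shows "continuous_on S (linear_extension W p)"
  unfolding linear_extension_def
  by (intro continuous_intros continuous_on_subset[OF continuous_on_product_coordinates]) simp

lemma linear_extension_std_basis:
  assumes "finite W" "w \<in> W"
  shows "linear_extension W p (std_basis w) = p w"
  using assms by (simp add: linear_extension_def std_basis_def if_distrib[of "\<lambda>c. c *\<^sub>R _"] cong: if_cong)

text \<open>Linear maps commute with convex hulls, so only the vertices of the simplex have to be
  tracked.\<close>

lemma linear_extension_face_realization:
  assumes "finite W" "F \<subseteq> W"
  shows "linear_extension W p ` face_realization F = convex hull (p ` F)"
proof -
  have "linear_extension W p ` std_basis ` F = p ` F"
    unfolding image_image using assms
    by (intro image_cong) (auto simp: linear_extension_std_basis)
  then show ?thesis
    by (simp add: face_realization_def convex_hull_linear_image[OF linear_linear_extension])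
qed

lemma linear_faithful_if_representable:
  fixes V :: "'a set"
  assumes K: "abstract_complex V K" and "representable TYPE('d::finite) V K"
  shows "\<exists>f :: ('a set \<Rightarrow> real) \<Rightarrow> real ^ 'd.
    linear_on_realization (dual_complex V K) f \<and> faithful V K f"
proof -
  obtain C :: "'a \<Rightarrow> (real ^ 'd) set"
    where conv: "\<And>i. i \<in> V \<Longrightarrow> convex (C i)"
      and repr: "K = {I. I \<subseteq> V \<and> (\<Inter>i\<in>I. C i) \<noteq> {}}"
    using assms(2) unfolding representable_def by blast
  \<comment> \<open>Points are chosen for all faces; the map below uses only those of
    facets.\<close>
  have "\<forall>J\<in>K. \<exists>x. \<forall>i\<in>J. x \<in> C i"
    unfolding repr by blast
  then obtain p where p: "\<And>J i. J \<in> K \<Longrightarrow> i \<in> J \<Longrightarrow> p J \<in> C i"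
    by metis
  let ?f = "linear_extension (facets K) p"
  have image: "?f ` face_realization (facets_at K i) \<subseteq> C i" if "i \<in> V" for i
  proof -
    have "?f ` face_realization (facets_at K i) = convex hull (p ` facets_at K i)"
      by (rule linear_extension_face_realization[OF finite_facets[OF K]]) (auto simp: facets_at_def)
    also have "\<dots> \<subseteq> C i"
      using p conv[OF that] by (intro hull_minimal) (auto simp: facets_at_def facets_def)
    finally show ?thesis .
  qed
  have "I \<in> K" if "I \<subseteq> V" "(\<Inter>i\<in>I. ?f ` face_realization (facets_at K i)) \<noteq> {}" for I
  proof -
    \<comment> \<open>A common point of the images is a common point of the \<open>C i\<close>,
      which certifies \<open>I\<close> as a face. For empty \<open>I\<close> both sides are the
      whole space.\<close>
    have "(\<Inter>i\<in>I. ?f ` face_realization (facets_at K i)) \<subseteq> (\<Inter>i\<in>I. C i)"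
      using that(1) by (intro INF_superset_mono image) auto
    with that show ?thesis
      unfolding repr by blast
  qed
  then have "faithful V K ?f"
    by (simp add: faithful_def continuous_on_linear_extension)
  moreover have "linear_on_realization (dual_complex V K) ?f"
    by (simp add: linear_on_realization_def linear_imp_affine_map_on linear_linear_extension)
  ultimately show ?thesis
    by blast
qed

theorem theorem3p3:
  fixes V :: "'a set" and K :: "'a set set"
  assumes "abstract_complex V K"
  shows "representable TYPE('d::finite) V K \<longleftrightarrow>
    (\<exists>f :: ('a set \<Rightarrow> real) \<Rightarrow> real ^ 'd.
       linear_on_realization (dual_complex V K) f \<and> faithful V K f)"
  using representable_if_linear_faithful[OF assms] linear_faithful_if_representable[OF assms]
  by blast

end
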